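(* Consider the bilinear system on $\mathrm{SL}(n)$ $$\dot X(t)=AX(t)+\Big(\sum_{k=1}^{m_1}u_k(t)E_{i_kj_k}+\sum_{k=m_1+1}^{m_2}u_k(t)C_{i_kj_k}\Big)X(t),\qquad X(0)=I_n,$$ with $A\in\mathfrak{sl}(n)$, $E_{i_kj_k}\in\{E_{ij}:1\le i\ne j\le n\}$ for $k=1,\dots,m_1$, and $C_{i_kj_k}\in\{C_{ij}:1\le i\ne j\le n\}$ for $k=m_1+1,\dots,m_2$. Suppose $A=0$. Then the system is controllable on the Lie group $\mathrm{SL}(n)$ if and only if the digraph $\mathcal{G}_{\rm contr}$ is strongly connected.
   Context: $\mathrm{SL}(n)$ is the group of real $n\times n$ matrices of determinant one, and $\mathfrak{sl}(n)$ is its Lie algebra of real traceless $n\times n$ matrices. $E_{ij}\in\mathbb{R}^{n\times n}$ has $(i,j)$-entry $1$ and all other entries $0$, and $C_{ij}=E_{ii}-E_{jj}$. The controls $u_k(t)\in\mathbb{R}$, $k=1,\dots,m_2$, are piecewise constant functions. For $T\ge 0$, $\mathcal{R}_T(I_n)$ is the set of all terminal points $X(T)$ of solutions of the system with $X(0)=I_n$ (over all admissible controls), and $\mathcal{R}(I_n)=\bigcup_{T\ge 0}\mathcal{R}_T(I_n)$. The system is controllable on $\mathrm{SL}(n)$ if $\mathcal{R}(I_n)=\mathrm{SL}(n)$. Let $\mathrm{V}=\{1,\dots,n\}$. The controlled interaction graph is the digraph $\mathcal{G}_{\rm contr}=(\mathrm{V},\mathcal{E}_{\rm contr})$ with arc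 set $\mathcal{E}_{\rm contr}=\{(i_1,j_1),\dots,(i_{m_1},j_{m_1})\}$ (the terms $C_{i_kj_k}$ do not contribute arcs). A digraph is strongly connected if every two nodes are mutually reachable by directed paths; a node is reachable from itself. *)

theory Defs
  imports "HOL-Analysis.Analysis" "Graph_Theory.Pair_Digraph" "Graph_Theory.Digraph_Component"
begin

text \<open>The vertex set \<open>{1,\<dots>,n}\<close> is rendered by the finite index type \<open>'n\<close>, so that
  \<open>n = CARD('n) \<ge> 1\<close>.\<close>

definition SL :: "(real^'n^'n) set" where
  "SL = {X. det X = 1}"

definition sl :: "(real^'n^'n) set" where
  "sl = {A. trace A = 0}"

definition E_mat :: "'n \<Rightarrow> 'n \<Rightarrow> real^'n^'n" where
  "E_mat i j = (\<chi> k l. if k = i \<and> l = j then 1 else 0)"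

definition C_mat :: "'n \<Rightarrow> 'n \<Rightarrow> real^'n^'n" where
  "C_mat i j = E_mat i i - E_mat j j"

text \<open>\<open>S\<close> contains the switching times; the value at a switching time is arbitrary.\<close>

definition piecewise_constant_on :: "(real \<Rightarrow> real) \<Rightarrow> real \<Rightarrow> bool" where
  "piecewise_constant_on f T \<longleftrightarrow>
     (\<exists>S. finite S \<and> (\<forall>a b. {a..b} \<subseteq> {0..T} - S \<longrightarrow> f constant_on {a..b}))"

definition system_matrix ::
  "real^'n^'n \<Rightarrow> (nat \<Rightarrow> 'n) \<Rightarrow> (nat \<Rightarrow> 'n) \<Rightarrow> nat \<Rightarrow> nat \<Rightarrow> (nat \<Rightarrow> real \<Rightarrow> real) \<Rightarrow> real \<Rightarrow> real^'n^'n"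
where
  "system_matrix A i j m1 m2 u t =
     A + ((\<Sum>k = 1..m1. u k t *\<^sub>R E_mat (i k) (j k)) +
          (\<Sum>k = m1 + 1..m2. u k t *\<^sub>R C_mat (i k) (j k)))"

text \<open>The controls may jump, so a solution is a continuous curve satisfying the differential
  equation at all but finitely many times.\<close>

definition is_solution ::
  "real^'n^'n \<Rightarrow> (nat \<Rightarrow> 'n) \<Rightarrow> (nat \<Rightarrow> 'n) \<Rightarrow> nat \<Rightarrow> nat \<Rightarrow> (nat \<Rightarrow> real \<Rightarrow> real) \<Rightarrow> real \<Rightarrow>
   (real \<Rightarrow> real^'n^'n) \<Rightarrow> bool"
where
  "is_solution A i j m1 m2 u T X \<longleftrightarrow>
     continuous_on {0..T} X \<and>
     (\<exists>S. finite S \<and>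
       (\<forall>t\<in>{0..T} - S.
          (X has_vector_derivative (system_matrix A i j m1 m2 u t ** X t)) (at t within {0..T})))"

definition reachable_set_at ::
  "real^'n^'n \<Rightarrow> (nat \<Rightarrow> 'n) \<Rightarrow> (nat \<Rightarrow> 'n) \<Rightarrow> nat \<Rightarrow> nat \<Rightarrow> real \<Rightarrow> real^'n^'n \<Rightarrow> (real^'n^'n) set"
where
  "reachable_set_at A i j m1 m2 T X0 =
     {X T | u X. (\<forall>k\<in>{1..m2}. piecewise_constant_on (u k) T) \<and>
                 is_solution A i j m1 m2 u T X \<and> X 0 = X0}"

definition reachable_set ::
  "real^'n^'n \<Rightarrow> (nat \<Rightarrow> 'n) \<Rightarrow> (nat \<Rightarrow> 'n) \<Rightarrow> nat \<Rightarrow> nat \<Rightarrow> real^'n^'n \<Rightarrow> (real^'n^'n) set"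
where
  "reachable_set A i j m1 m2 X0 = (\<Union>T\<in>{0..}. reachable_set_at A i j m1 m2 T X0)"

definition controllable_on_SL ::
  "real^'n^'n \<Rightarrow> (nat \<Rightarrow> 'n) \<Rightarrow> (nat \<Rightarrow> 'n) \<Rightarrow> nat \<Rightarrow> nat \<Rightarrow> bool"
where
  "controllable_on_SL A i j m1 m2 \<longleftrightarrow> reachable_set A i j m1 m2 (mat 1) = SL"

definition contr_graph :: "(nat \<Rightarrow> 'n) \<Rightarrow> (nat \<Rightarrow> 'n) \<Rightarrow> nat \<Rightarrow> 'n pair_pre_digraph" where
  "contr_graph i j m1 = \<lparr> pverts = UNIV, parcs = {(i k, j k) | k. k \<in> {1..m1}} \<rparr>"

end

theory Submission
  imports Defs
begin

text \<open>
  With zero drift a single control that drives the arc \<open>(p, q)\<close> for unit time multiplies the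
  state from the left by the transvection \<open>I + c E\<^sub>p\<^sub>q\<close>, for any real \<open>c\<close>: it adds \<open>c\<close> times row \<open>q\<close>
  to row \<open>p\<close>.  So the reachable set contains the identity and is closed under these row
  operations along arcs.  The commutator of the transvections of the arcs \<open>(p, q)\<close> and \<open>(q, r)\<close> is
  a transvection for \<open>(p, r)\<close>, and hence row operations along every directed path are available
  (\<open>path_shear_closed\<close>).  If the graph is strongly connected these are all row operations, and
  Gaussian elimination generates the whole of \<open>SL\<close> from them
  (\<open>SL_subset_if_shear_closed\<close>).  Conversely the state never leaves \<open>SL\<close>, because every
  system matrix is traceless and Jacobi's formula makes the determinant constant
  (\<open>det_constant\<close>).

  If some \<open>q\<close> cannot be reached from \<open>p\<close>, let \<open>R\<close> be the set of vertices reachable from \<open>p\<close>.  No arc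
  leaves \<open>R\<close>, so every system matrix vanishes on the block \<open>R \<times> (- R)\<close>: the rows of the state with
  index in \<open>R\<close> evolve among themselves.  The identity vanishes on this block, and uniqueness for
  linear equations, in the form of a Gronwall estimate, keeps the block zero
  (\<open>zero_block_invariant\<close>).  The transvection \<open>I + E\<^sub>p\<^sub>q\<close> is in \<open>SL\<close> but not zero there, so it is not
  reachable.
\<close>

section \<open>Generating the special linear group by row operations\<close>

text \<open>
  This is \<open>(I + c E\<^sub>p\<^sub>q) X\<close>, written entrywise so that identities between products of
  transvections can be checked on entries.
\<close>

definition shear :: "'n \<Rightarrow> 'n \<Rightarrow> real \<Rightarrow> real^'n^'n \<Rightarrow> real^'n^'n" where
  "shear p q c X = (\<chi> r s. X $ r $ s + (if r = p then c * X $ q $ s else 0))"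

lemma shear_nth [simp]:
  "shear p q c X $ r $ s = X $ r $ s + (if r = p then c * X $ q $ s else 0)"
  by (simp add: shear_def)

lemma shear_eq_row_operation:
  "shear p q c X = (\<chi> k. if k = p then row p X + c *s row q X else row k X)"
  by (simp add: vec_eq_iff row_def)

lemma det_shear: "p \<noteq> q \<Longrightarrow> det (shear p q c X) = det X"
  unfolding shear_eq_row_operation by (rule det_row_operation)

text \<open>
  The group commutator of \<open>I + c E\<^sub>p\<^sub>q\<close> and \<open>I + E\<^sub>q\<^sub>r\<close> is \<open>I + c E\<^sub>p\<^sub>r\<close>, because
  \<open>E\<^sub>p\<^sub>q E\<^sub>q\<^sub>r = E\<^sub>p\<^sub>r\<close> while all other products that occur vanish.
\<close>

lemma shear_commutator:
  assumes "p \<noteq> q" "q \<noteq> r" "p \<noteq> r"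
  shows "shear p r c X =
    shear p q c (shear q r 1 (shear p q (- c) (shear q r (- 1) X)))"
  using assms by (auto simp: vec_eq_iff algebra_simps)

text \<open>
  The quarter turn \<open>(x, y) \<mapsto> (y, - x)\<close> as a product of three transvections.  A swap without
  the sign has determinant \<open>-1\<close> and is out of reach.
\<close>

lemma signed_swap_by_shears:
  assumes "p \<noteq> q"
  shows "shear p q 1 (shear q p (- 1) (shear p q 1 X)) =
    (\<chi> r s. if r = p then X $ q $ s else if r = q then - X $ p $ s else X $ r $ s)"
  using assms by (auto simp: vec_eq_iff)

text \<open>
  Whitehead's factorisation of \<open>diag(d, 1/d)\<close> into transvections: the rows \<open>(x, y)\<close> become in turn
  \<open>(x, y + (d - 1) x)\<close>, \<open>(d x + y, y + (d - 1) x)\<close>, \<open>(d x + y, y / d)\<close> and \<open>(d x, y / d)\<close>.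
\<close>

lemma row_scaling_by_shears:
  assumes "p \<noteq> q" "d \<noteq> 0"
  shows "shear p q (- d) (shear q p (1 / d - 1) (shear p q 1 (shear q p (d - 1) X))) =
    (\<chi> r s. if r = p then d * X $ p $ s else if r = q then X $ q $ s / d else X $ r $ s)"
  using assms by (auto simp: vec_eq_iff field_simps)

text \<open>
  Row operations preserve the determinant, so they cannot reduce an invertible matrix to the
  identity; this one-parameter family serves as the set of normal forms.
\<close>

definition single_diag :: "'n \<Rightarrow> real \<Rightarrow> real^'n^'n" where
  "single_diag v d = (\<chi> r s. if r = s then (if r = v then d else 1) else 0)"

inductive_set shear_orbit :: "'n \<Rightarrow> (real^'n^'n) set" for v :: 'n where
  base: "d \<noteq> 0 \<Longrightarrow> single_diag v d \<in> shear_orbit v"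
| shear: "X \<in> shear_orbit v \<Longrightarrow> p \<noteq> q \<Longrightarrow> shear p q c X \<in> shear_orbit v"

text \<open>
  Row scaling moves one diagonal entry after another into position \<open>v\<close>; the set \<open>K\<close> bounds the
  positions that still carry an entry other than \<open>1\<close>.
\<close>

lemma diagonal_in_shear_orbit:
  fixes D :: "real^'n^'n"
  assumes "finite K" "v \<notin> K" "\<And>r s. r \<noteq> s \<Longrightarrow> D $ r $ s = 0" "\<And>r. D $ r $ r \<noteq> 0"
    "\<And>r. r \<notin> insert v K \<Longrightarrow> D $ r $ r = 1"
  shows "D \<in> shear_orbit v"
  using assms
proof (induction K arbitrary: D rule: finite_induct)
  case empty
  have "D = single_diag v (D $ v $ v)"
    using empty.prems by (auto simp: vec_eq_iff single_diag_def)
  then show ?case using empty.prems(3) shear_orbit.base by metis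
next
  case (insert p K)
  define d where "d = D $ p $ p"
  \<comment> \<open>the entry at \<open>p\<close> has been absorbed into the one at \<open>v\<close>; scaling row \<open>p\<close> by \<open>d\<close> and row \<open>v\<close>
     by \<open>1 / d\<close> gives \<open>D\<close> back\<close>
  define D' where "D' = (\<chi> r s. if r = s then (if r = p then 1 else if r = v then d * D $ v $ v
     else D $ r $ r) else 0)"
  have d: "d \<noteq> 0" and pv: "p \<noteq> v" using insert by (auto simp: d_def)
  have "D' \<in> shear_orbit v"
    by (rule insert.IH) (use insert.prems insert.hyps d in \<open>auto simp: D'_def\<close>)
  then have "shear p v (- d) (shear v p (1 / d - 1) (shear p v 1 (shear v p (d - 1) D')))
      \<in> shear_orbit v"
    using pv by (intro shear_orbit.shear) auto
  also have "shear p v (- d) (shear v p (1 / d - 1) (shear p v 1 (shear v p (d - 1) D'))) = D"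
    unfolding row_scaling_by_shears[OF pv d]
    using insert.prems d pv by (auto simp: vec_eq_iff D'_def d_def)
  finally show ?case .
qed

lemma invertible_diagonal_in_shear_orbit:
  fixes D :: "real^'n^'n"
  assumes "\<And>r s. r \<noteq> s \<Longrightarrow> D $ r $ s = 0" "\<And>r. D $ r $ r \<noteq> 0"
  shows "D \<in> shear_orbit v"
  by (rule diagonal_in_shear_orbit[of "UNIV - {v}"]) (use assms in auto)

text \<open>
  Column swaps commute with row operations, so only a normal form has to be treated.  There
  the column swap turns a diagonal matrix into one that is also a signed row swap of another
  diagonal matrix.
\<close>

lemma swap_columns_in_shear_orbit:
  fixes X :: "real^'n^'n"
  assumes "X \<in> shear_orbit v" "m \<noteq> n"
  shows "(\<chi> r s. X $ r $ Transposition.transpose m n s) \<in> shear_orbit v"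
  using assms(1)
proof induction
  case (base d)
  define D :: "real^'n^'n" where "D = (\<chi> r s. if r = s then
     (if r = m then - single_diag v d $ n $ n else if r = n then single_diag v d $ m $ m
      else single_diag v d $ r $ r) else 0)"
  have "D \<in> shear_orbit v"
    by (rule invertible_diagonal_in_shear_orbit)
      (use base in \<open>auto simp: D_def single_diag_def\<close>)
  then have "shear m n 1 (shear n m (- 1) (shear m n 1 D)) \<in> shear_orbit v"
    using assms(2) by (intro shear_orbit.shear) auto
  also have "shear m n 1 (shear n m (- 1) (shear m n 1 D)) =
      (\<chi> r s. single_diag v d $ r $ Transposition.transpose m n s)"
    unfolding signed_swap_by_shears[OF assms(2)] using assms(2)
    by (auto simp: vec_eq_iff D_def single_diag_def Transposition.transpose_def)
  finally show ?case .
next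
  case (shear X p q c)
  have "(\<chi> r s. shear p q c X $ r $ Transposition.transpose m n s) =
      shear p q c (\<chi> r s. X $ r $ Transposition.transpose m n s)"
    by (simp add: vec_eq_iff)
  then show ?case using shear by (simp add: shear_orbit.shear)
qed

text \<open>
  Gaussian elimination.
\<close>

lemma invertible_in_shear_orbit:
  fixes X :: "real^'n^'n"
  shows "det X \<noteq> 0 \<Longrightarrow> X \<in> shear_orbit v"
proof (induction X rule: induct_matrix_row_operations)
  case (1 A i)
  then show ?case by (simp add: det_zero_row)
next
  case (2 A)
  then have "(\<Prod>r\<in>UNIV. A $ r $ r) \<noteq> 0" using det_diagonal[of A] by metis
  then show ?case using 2 by (intro invertible_diagonal_in_shear_orbit) auto
next
  case (3 A m n)
  have "det (\<chi> r s. A $ r $ Transposition.transpose m n s)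
      = of_int (sign (Transposition.transpose m n)) * det A"
    by (rule det_permute_columns) (simp add: permutes_swap_id)
  then have "det A \<noteq> 0" using "3.prems" by auto
  then show ?case using 3 by (intro swap_columns_in_shear_orbit) auto
next
  case (4 A m n c)
  then show ?case
    unfolding shear_eq_row_operation[symmetric] scalar_mult_eq_scaleR[symmetric]
    by (auto simp: det_shear intro: shear_orbit.shear)
qed

text \<open>
  The normal form of a matrix of determinant one is the identity, since the determinant is
  invariant along the reduction.
\<close>

theorem SL_subset_if_shear_closed:
  fixes G :: "(real^'n^'n) set"
  assumes one: "mat 1 \<in> G"
    and closed: "\<And>p q c X. p \<noteq> q \<Longrightarrow> X \<in> G \<Longrightarrow> shear p q c X \<in> G"
  shows "SL \<subseteq> G"
proof
  fix X :: "real^'n^'n" assume "X \<in> SL"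
  then have det: "det X = 1" by (simp add: SL_def)
  \<comment> \<open>any index will do\<close>
  define v :: 'n where "v = undefined"
  have "X \<in> shear_orbit v" using det by (intro invertible_in_shear_orbit) simp
  then show "X \<in> G" using det
  proof induction
    case (base d)
    have "det (single_diag v d) = (\<Prod>r\<in>UNIV. if r = v then d else 1)"
      by (subst det_diagonal) (auto simp: single_diag_def)
    also have "\<dots> = d" by simp
    finally have "single_diag v d = mat 1"
      using base by (simp add: vec_eq_iff single_diag_def mat_def)
    then show ?case using one by simp
  next
    case (shear X p q c)
    then show ?case by (simp add: det_shear closed)
  qed
qed

text \<open>
  Induction along the path: a further arc \<open>(q, r)\<close> extends a transvection for \<open>(p, q)\<close> to one for
  \<open>(p, r)\<close> by taking the commutator.
\<close>

lemma path_shear_closed: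
  fixes E :: "('n::finite \<times> 'n) set" and G :: "(real^'n^'n) set"
  assumes arcs: "\<And>p q c X. (p, q) \<in> E \<Longrightarrow> X \<in> G \<Longrightarrow> shear p q c X \<in> G"
    and path: "(p, q) \<in> E\<^sup>*" and "p \<noteq> q" and "X \<in> G"
  shows "shear p q c X \<in> G"
proof -
  have "p \<noteq> q \<longrightarrow> (\<forall>c. \<forall>X\<in>G. shear p q c X \<in> G)"
    using path
  proof induction
    case (step q r)
    show ?case
    proof (cases "p = q \<or> q = r")
      case True
      then show ?thesis using step arcs by auto
    next
      case False
      then show ?thesis using step arcs shear_commutator[of p q r] by auto
    qed
  qed simp
  then show ?thesis using assms by blast
qed

section \<open>Linear differential equations with exceptional times\<close>

text \<open>
  Off \<open>S\<close> the value at \<open>t\<close> depends only on which switching times precede \<open>t\<close>, and there are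
  finitely many possibilities for these.
\<close>

lemma piecewise_constant_on_finite_range:
  assumes "piecewise_constant_on f T"
  shows "finite (f ` {0..T})"
proof -
  obtain S where S: "finite S"
    and const: "\<And>a b. {a..b} \<subseteq> {0..T} - S \<Longrightarrow> f constant_on {a..b}"
    using assms unfolding piecewise_constant_on_def by blast
  define A where "A = {0..T} - S"
  define left where "left t = {s \<in> S. s < t}" for t
  have eq: "f a = f b" if "a \<in> A" "b \<in> A" "left a = left b" "a \<le> b" for a b
  proof -
    have "s \<notin> {a..b}" if "s \<in> S" for s
    proof
      assume s: "s \<in> {a..b}"
      with that \<open>b \<in> A\<close> have "s < b" by (metis A_def DiffD2 atLeastAtMost_iff order_le_less)
      with that \<open>left a = left b\<close> have "s < a" by (auto simp: left_def)
      with s show False by simp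
    qed
    then have "{a..b} \<subseteq> {0..T} - S" using that by (auto simp: A_def)
    from const[OF this] show ?thesis using \<open>a \<le> b\<close> by (auto simp: constant_on_def)
  qed
  have "f ` A \<subseteq> (\<lambda>P. f (SOME t. t \<in> A \<and> left t = P)) ` Pow S"
  proof
    fix y assume "y \<in> f ` A"
    then obtain a where a: "a \<in> A" "y = f a" by blast
    define b where "b = (SOME t. t \<in> A \<and> left t = left a)"
    have b: "b \<in> A \<and> left b = left a"
      unfolding b_def by (rule someI[of _ a]) (use a in simp)
    then have "f a = f b" by (metis eq a(1) linear)
    moreover have "left a \<in> Pow S" by (auto simp: left_def)
    ultimately show "y \<in> (\<lambda>P. f (SOME t. t \<in> A \<and> left t = P)) ` Pow S"
      using a b_def by blast
  qed
  then have "finite (f ` A)" using S by (meson finite_Pow_iff finite_imageI finite_subset)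
  then have "finite (f ` A \<union> f ` S)" using S by simp
  then show ?thesis by (rule rev_finite_subset) (auto simp: A_def)
qed

text \<open>
  The function \<open>exp (- K t) f t\<close> has nonpositive derivative away from \<open>S\<close> and starts at zero.
\<close>

lemma gronwall_zero:
  fixes f f' :: "real \<Rightarrow> real"
  assumes "0 \<le> T" "finite S" "continuous_on {0..T} f"
    and deriv: "\<And>t. t \<in> {0<..<T} - S \<Longrightarrow> (f has_real_derivative f' t) (at t)"
    and le: "\<And>t. t \<in> {0<..<T} - S \<Longrightarrow> f' t \<le> K * f t"
    and "f 0 = 0" "0 \<le> f T"
  shows "f T = 0"
proof -
  define g where "g t = exp (- K * t) * f t" for t
  define g' where "g' t = (if t \<in> {0<..<T} - S then exp (- K * t) * (f' t - K * f t) else 0)" for t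
  have int: "(g' has_integral (g T - g 0)) {0..T}"
  proof (rule fundamental_theorem_of_calculus_interior_strong[OF \<open>finite S\<close> \<open>0 \<le> T\<close>])
    show "(g has_vector_derivative g' t) (at t)" if "t \<in> {0<..<T} - S" for t
      unfolding has_real_derivative_iff_has_vector_derivative[symmetric] g_def
      by (rule derivative_eq_intros deriv[OF that] refl)+
        (use that in \<open>simp add: g'_def algebra_simps\<close>)
    show "continuous_on {0..T} g"
      unfolding g_def by (intro continuous_intros assms)
  qed
  have "g' t \<le> 0" for t
    using le by (simp add: g'_def mult_nonneg_nonpos)
  then have "g T - g 0 \<le> 0"
    using has_integral_le[OF int has_integral_0] by simp
  then have "exp (- K * T) * f T \<le> 0" using \<open>f 0 = 0\<close> by (simp add: g_def)
  then have "f T \<le> 0" by (simp add: mult_le_0_iff)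
  then show ?thesis using \<open>0 \<le> f T\<close> by simp
qed

lemma has_vector_derivative_matrix_entry:
  fixes X :: "real \<Rightarrow> real^'n^'m"
  assumes "(X has_vector_derivative D) F"
  shows "((\<lambda>t. X t $ r $ s) has_vector_derivative D $ r $ s) F"
  using bounded_linear.has_vector_derivative[OF bounded_linear_vec_nth
      bounded_linear.has_vector_derivative[OF bounded_linear_vec_nth assms]] .

text \<open>
  The entries of column \<open>l\<close> with row index in \<open>R\<close> satisfy a homogeneous linear equation of their
  own, because the coefficients that couple them to the other rows vanish.  Gronwall's
  inequality is applied to the sum of their squares.
\<close>

lemma zero_block_invariant:
  fixes X B :: "real \<Rightarrow> real^'n^'n"
  assumes "0 \<le> T" "finite S" "continuous_on {0..T} X"
    and deriv: "\<And>t. t \<in> {0..T} - S \<Longrightarrow>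
        (X has_vector_derivative B t ** X t) (at t within {0..T})"
    and bound: "\<And>t. t \<in> {0..T} \<Longrightarrow> norm (B t) \<le> M"
    and inv: "\<And>t p q. p \<in> R \<Longrightarrow> q \<notin> R \<Longrightarrow> B t $ p $ q = 0"
    and init: "\<And>p. p \<in> R \<Longrightarrow> X 0 $ p $ l = 0"
    and "p \<in> R"
  shows "X T $ p $ l = 0"
proof -
  define x where "x p t = X t $ p $ l" for p t
  define f where "f t = (\<Sum>p\<in>R. (x p t)\<^sup>2)" for t
  define f' where "f' t = (\<Sum>p\<in>R. \<Sum>q\<in>R. 2 * x p t * (B t $ p $ q * x q t))" for t
  have "0 \<le> M" using order_trans[OF norm_ge_zero bound[of 0]] \<open>0 \<le> T\<close> by simp
  have entry: "\<bar>B t $ p $ q\<bar> \<le> M" if "t \<in> {0..T}" for t p q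
    using component_le_norm_cart[of "B t $ p" q] Finite_Cartesian_Product.norm_nth_le[of "B t" p] bound[OF that]
    by linarith
  have "f T = 0"
  proof (rule gronwall_zero[OF \<open>0 \<le> T\<close> \<open>finite S\<close>, where f' = f' and K = "2 * M * card R"])
    show "continuous_on {0..T} f"
      unfolding f_def x_def by (intro continuous_intros assms)
  next
    fix t assume t: "t \<in> {0<..<T} - S"
    have "at t within {0..T} = at t" using t by (intro at_within_interior) auto
    then have "(X has_vector_derivative B t ** X t) (at t)" using deriv[of t] t by auto
    then have "(x p has_real_derivative (B t ** X t) $ p $ l) (at t)" for p
      unfolding x_def has_real_derivative_iff_has_vector_derivative
      by (rule has_vector_derivative_matrix_entry)
    moreover have "(B t ** X t) $ p $ l = (\<Sum>q\<in>R. B t $ p $ q * x q t)" if "p \<in> R" for p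
      unfolding matrix_matrix_mult_def x_def
      using that by (auto intro!: sum.mono_neutral_right simp: inv)
    ultimately have "(x p has_real_derivative (\<Sum>q\<in>R. B t $ p $ q * x q t)) (at t)"
      if "p \<in> R" for p using that by metis
    then have "((\<lambda>t. (x p t)\<^sup>2) has_real_derivative
        (\<Sum>q\<in>R. 2 * x p t * (B t $ p $ q * x q t))) (at t)" if "p \<in> R" for p
      using that by (auto intro!: derivative_eq_intros simp: sum_distrib_left algebra_simps)
    then show "(f has_real_derivative f' t) (at t)"
      unfolding f_def f'_def by (intro DERIV_sum)
    \<comment> \<open>Summing this over \<open>p\<close> and \<open>q\<close> counts every square \<open>2 * card R\<close> times.\<close>
    have "2 * x p t * (B t $ p $ q * x q t) \<le> M * ((x p t)\<^sup>2 + (x q t)\<^sup>2)" for p q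
    proof -
      have "2 * x p t * (B t $ p $ q * x q t) \<le> \<bar>B t $ p $ q\<bar> * (2 * \<bar>x p t\<bar> * \<bar>x q t\<bar>)"
        using abs_ge_self[of "2 * x p t * (B t $ p $ q * x q t)"]
        by (simp add: abs_mult algebra_simps)
      also have "\<dots> \<le> M * (2 * \<bar>x p t\<bar> * \<bar>x q t\<bar>)"
        using entry[of t p q] t by (intro mult_right_mono) auto
      also have "\<dots> \<le> M * ((x p t)\<^sup>2 + (x q t)\<^sup>2)"
        using sum_squares_bound[of "\<bar>x p t\<bar>" "\<bar>x q t\<bar>"] \<open>0 \<le> M\<close>
        by (intro mult_left_mono) auto
      finally show ?thesis .
    qed
    then have "f' t \<le> (\<Sum>p\<in>R. \<Sum>q\<in>R. M * ((x p t)\<^sup>2 + (x q t)\<^sup>2))"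
      unfolding f'_def by (intro sum_mono)
    also have "\<dots> = 2 * M * card R * f t"
      by (simp add: f_def sum.distrib sum_distrib_left[symmetric] algebra_simps)
    finally show "f' t \<le> 2 * M * card R * f t" .
  next
    show "f 0 = 0" using init by (simp add: f_def x_def)
    show "0 \<le> f T" by (simp add: f_def sum_nonneg)
  qed
  then show ?thesis using \<open>p \<in> R\<close> by (auto simp: f_def x_def sum_nonneg_eq_0_iff)
qed

text \<open>
  Row \<open>p\<close> of \<open>B X\<close> is a combination of the rows of \<open>X\<close>, and only its multiple of row \<open>p\<close> itself
  contributes: every other term has two equal rows.
\<close>

lemma det_replace_row_by_product_row:
  fixes B X :: "real^'n^'n"
  shows "det (\<chi> k. if k = p then (B ** X) $ p else X $ k) = B $ p $ p * det X"
proof -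
  have "(B ** X) $ p = (\<Sum>q\<in>UNIV. B $ p $ q *s X $ q)"
    by (simp add: vec_eq_iff matrix_matrix_mult_def sum_component)
  then have "det (\<chi> k. if k = p then (B ** X) $ p else X $ k) =
      (\<Sum>q\<in>UNIV. B $ p $ q * det (\<chi> k. if k = p then X $ q else X $ k))"
    by (simp only: det_linear_row_sum[OF finite_class.finite_UNIV] det_row_mul)
  also have "\<dots> = (\<Sum>q\<in>UNIV. if q = p then B $ p $ p * det X else 0)"
  proof (rule sum.cong)
    fix q
    have "(\<chi> k. if k = p then X $ p else X $ k) = X" by (simp add: vec_eq_iff)
    moreover have "det (\<chi> k. if k = p then X $ q else X $ k) = 0" if "q \<noteq> p"
      using that by (intro det_identical_rows[of p q]) (auto simp: row_def)
    ultimately show "B $ p $ q * det (\<chi> k. if k = p then X $ q else X $ k) =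
        (if q = p then B $ p $ p * det X else 0)" by auto
  qed simp
  finally show ?thesis by simp
qed

text \<open>
  Jacobi's formula.  The product rule in the Leibniz expansion gives the sum, over all rows, of
  the determinants in which that row is replaced by its derivative.
\<close>

lemma has_vector_derivative_det:
  fixes X :: "real \<Rightarrow> real^'n^'n"
  assumes "(X has_vector_derivative B ** X t) (at t within A)"
  shows "((\<lambda>t. det (X t)) has_vector_derivative trace B * det (X t)) (at t within A)"
proof -
  define D where "D = B ** X t"
  have entry: "((\<lambda>t. X t $ r $ s) has_derivative (\<lambda>h. h * D $ r $ s)) (at t within A)" for r s
    using has_vector_derivative_matrix_entry[OF assms, of r s]
    by (simp add: has_vector_derivative_def D_def)
  let ?P = "{\<pi>. \<pi> permutes (UNIV :: 'n set)}"
  have "((\<lambda>t. det (X t)) has_derivative (\<lambda>h. \<Sum>\<pi>\<in>?P. of_int (sign \<pi>) *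
      (\<Sum>r\<in>UNIV. (h * D $ r $ \<pi> r) * (\<Prod>k\<in>UNIV - {r}. X t $ k $ \<pi> k)))) (at t within A)"
    unfolding det_def
    by (intro has_derivative_sum has_derivative_mult_right has_derivative_prod entry)
  also have "(\<lambda>h. \<Sum>\<pi>\<in>?P. of_int (sign \<pi>) *
      (\<Sum>r\<in>UNIV. (h * D $ r $ \<pi> r) * (\<Prod>k\<in>UNIV - {r}. X t $ k $ \<pi> k))) =
      (\<lambda>h. h * (\<Sum>r\<in>UNIV. det (\<chi> k. if k = r then D $ r else X t $ k)))"
  proof
    fix h
    have "det (\<chi> k. if k = r then D $ r else X t $ k) =
        (\<Sum>\<pi>\<in>?P. of_int (sign \<pi>) * (D $ r $ \<pi> r * (\<Prod>k\<in>UNIV - {r}. X t $ k $ \<pi> k)))" for r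
      unfolding det_def
    proof (rule sum.cong)
      fix \<pi>
      have "(\<Prod>k\<in>UNIV - {r}. (\<chi> k. if k = r then D $ r else X t $ k) $ k $ \<pi> k) =
          (\<Prod>k\<in>UNIV - {r}. X t $ k $ \<pi> k)" by (intro prod.cong) auto
      then show "of_int (sign \<pi>) * (\<Prod>k\<in>UNIV. (\<chi> k. if k = r then D $ r else X t $ k) $ k $ \<pi> k) =
          of_int (sign \<pi>) * (D $ r $ \<pi> r * (\<Prod>k\<in>UNIV - {r}. X t $ k $ \<pi> k))"
        by (subst prod.remove[of _ r]) auto
    qed simp
    then show "(\<Sum>\<pi>\<in>?P. of_int (sign \<pi>) *
      (\<Sum>r\<in>UNIV. (h * D $ r $ \<pi> r) * (\<Prod>k\<in>UNIV - {r}. X t $ k $ \<pi> k))) =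
      h * (\<Sum>r\<in>UNIV. det (\<chi> k. if k = r then D $ r else X t $ k))"
      by (simp add: sum_distrib_left sum.swap[of _ UNIV ?P] mult_ac)
  qed
  also have "(\<Sum>r\<in>UNIV. det (\<chi> k. if k = r then D $ r else X t $ k)) = trace B * det (X t)"
    unfolding D_def det_replace_row_by_product_row trace_def by (simp add: sum_distrib_right)
  finally show ?thesis by (simp add: has_vector_derivative_def)
qed

lemma det_constant:
  fixes X B :: "real \<Rightarrow> real^'n^'n"
  assumes "0 \<le> T" "finite S" "continuous_on {0..T} X"
    and deriv: "\<And>t. t \<in> {0..T} - S \<Longrightarrow>
        (X has_vector_derivative B t ** X t) (at t within {0..T})"
    and trace: "\<And>t. trace (B t) = 0"
  shows "det (X T) = det (X 0)"
proof (rule has_derivative_zero_unique_strong_interval[OF \<open>finite S\<close>,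
      where f = "\<lambda>t. det (X t)" and a = 0 and b = T])
  show "continuous_on {0..T} (\<lambda>t. det (X t))"
    unfolding det_def by (intro continuous_intros assms)
  show "((\<lambda>t. det (X t)) has_derivative (\<lambda>h. 0)) (at t within {0..T})"
    if "t \<in> {0..T} - S" for t
    using has_vector_derivative_det[OF deriv[OF that]]
    by (simp add: trace has_vector_derivative_def)
qed (use \<open>0 \<le> T\<close> in auto)

section \<open>Reachable states of the driftless system\<close>

lemma E_mat_nth [simp]: "E_mat p q $ r $ s = (if r = p \<and> s = q then 1 else 0)"
  by (simp add: E_mat_def)

lemma trace_E_mat: "trace (E_mat p q) = (if p = q then 1 else 0)"
proof -
  have "trace (E_mat p q) = (\<Sum>r\<in>UNIV. if r = p then (if p = q then 1 else 0) else 0)"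
    unfolding trace_def by (intro sum.cong) auto
  then show ?thesis by simp
qed

lemma E_mat_mult_nth [simp]: "(E_mat p q ** X) $ r $ s = (if r = p then X $ q $ s else 0)"
  by (cases "r = p")
    (simp_all add: matrix_matrix_mult_def if_distrib[of "\<lambda>x. x * _"] cong: if_cong)

lemma shear_eq_add_scaled_product:
  "shear p q c X = X + c *\<^sub>R (E_mat p q ** X)"
  by (simp add: vec_eq_iff)

lemma trace_sum: "trace (\<Sum>k\<in>K. F k) = (\<Sum>k\<in>K. trace (F k))"
  for F :: "'b \<Rightarrow> real^'n^'n"
  unfolding trace_def sum_component by (rule sum.swap)

lemma trace_scaleR: "trace (c *\<^sub>R M) = c * trace M" for M :: "real^'n^'n"
  by (simp add: trace_def sum_distrib_left)

lemma trace_system_matrix: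
  assumes "\<And>k. k \<in> {1..m1} \<Longrightarrow> i k \<noteq> j k"
  shows "trace (system_matrix 0 i j m1 m2 u t) = 0"
  using assms by (simp add: system_matrix_def trace_add trace_sum trace_scaleR trace_sub
      C_mat_def trace_E_mat)

text \<open>
  The matrices \<open>C\<^sub>i\<^sub>j\<close> are diagonal, which is why they contribute no arcs.
\<close>

lemma system_matrix_nth_eq_0:
  assumes "p \<noteq> q" "\<And>k. k \<in> {1..m1} \<Longrightarrow> (i k, j k) \<noteq> (p, q)"
  shows "system_matrix 0 i j m1 m2 u t $ p $ q = 0"
proof -
  have "(\<Sum>k = 1..m1. u k t * E_mat (i k) (j k) $ p $ q) = 0"
    using assms(2) by (intro sum.neutral) (metis E_mat_nth mult_zero_right)
  moreover have "(\<Sum>k = m1 + 1..m2. u k t * C_mat (i k) (j k) $ p $ q) = 0"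
    using assms(1) by (intro sum.neutral) (auto simp: C_mat_def)
  ultimately show ?thesis by (simp add: system_matrix_def sum_component)
qed

lemma bounded_control_combination:
  fixes F :: "nat \<Rightarrow> 'a::real_normed_vector"
  assumes "\<forall>k\<in>K. piecewise_constant_on (u k) T"
  obtains M where "\<And>t. t \<in> {0..T} \<Longrightarrow> norm (\<Sum>k\<in>K. u k t *\<^sub>R F k) \<le> M"
proof -
  have "\<exists>b. \<forall>t\<in>{0..T}. \<bar>u k t\<bar> \<le> b" if "k \<in> K" for k
    using finite_imp_bounded[OF piecewise_constant_on_finite_range[OF assms[rule_format, OF that]]]
    by (auto simp: bounded_iff)
  then obtain b where b: "\<And>k t. k \<in> K \<Longrightarrow> t \<in> {0..T} \<Longrightarrow> \<bar>u k t\<bar> \<le> b k" by metis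
  have "norm (\<Sum>k\<in>K. u k t *\<^sub>R F k) \<le> (\<Sum>k\<in>K. b k * norm (F k))" if "t \<in> {0..T}" for t
    using b that by (intro sum_norm_le) (simp add: mult_right_mono)
  then show ?thesis using that by blast
qed

lemma bounded_system_matrix:
  assumes "m1 \<le> m2" "\<forall>k\<in>{1..m2}. piecewise_constant_on (u k) T"
  obtains M where "\<And>t. t \<in> {0..T} \<Longrightarrow> norm (system_matrix A i j m1 m2 u t) \<le> M"
proof -
  have "\<forall>k\<in>{1..m1}. piecewise_constant_on (u k) T"
    and "\<forall>k\<in>{m1 + 1..m2}. piecewise_constant_on (u k) T"
    using assms by auto
  note bounds = this[THEN bounded_control_combination]
  obtain M where M: "\<And>t. t \<in> {0..T} \<Longrightarrow> norm (\<Sum>k = 1..m1. u k t *\<^sub>R E_mat (i k) (j k)) \<le> M"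
    using bounds(1)[of "\<lambda>k. E_mat (i k) (j k)"] by blast
  obtain N where N: "\<And>t. t \<in> {0..T} \<Longrightarrow> norm (\<Sum>k = m1 + 1..m2. u k t *\<^sub>R C_mat (i k) (j k)) \<le> N"
    using bounds(2)[of "\<lambda>k. C_mat (i k) (j k)"] by blast
  have "norm (system_matrix A i j m1 m2 u t) \<le> norm A + (M + N)" if "t \<in> {0..T}" for t
    unfolding system_matrix_def using M[OF that] N[OF that]
    by (intro norm_triangle_le add_left_mono) linarith
  then show ?thesis using that by blast
qed

lemma reachable_setE:
  assumes "Z \<in> reachable_set A i j m1 m2 X0"
  obtains T u S X where "0 \<le> T" "\<forall>l\<in>{1..m2}. piecewise_constant_on (u l) T"
    "finite S" "continuous_on {0..T} X"
    "\<forall>t\<in>{0..T} - S.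
      (X has_vector_derivative system_matrix A i j m1 m2 u t ** X t) (at t within {0..T})"
    "X 0 = X0" "X T = Z"
proof -
  obtain T u X where T: "0 \<le> T" and u: "\<forall>l\<in>{1..m2}. piecewise_constant_on (u l) T"
    and sol: "is_solution A i j m1 m2 u T X" and X: "X 0 = X0" "X T = Z"
    using assms unfolding reachable_set_def reachable_set_at_def UN_iff mem_Collect_eq atLeast_iff
    by blast
  obtain S where S: "finite S" "continuous_on {0..T} X"
    "\<forall>t\<in>{0..T} - S.
      (X has_vector_derivative system_matrix A i j m1 m2 u t ** X t) (at t within {0..T})"
    using sol unfolding is_solution_def by blast
  show thesis by (rule that[OF T u S X])
qed

lemma identity_reachable: "mat 1 \<in> reachable_set 0 i j m1 m2 (mat 1)"
proof -
  have "is_solution 0 i j m1 m2 (\<lambda>_ _. 0) 0 (\<lambda>_. mat 1)"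
    unfolding is_solution_def by (intro conjI exI[of _ "{0}"]) auto
  moreover have "piecewise_constant_on (\<lambda>_. 0) 0"
    unfolding piecewise_constant_on_def by (intro exI[of _ "{}"]) (auto simp: constant_on_def)
  ultimately have "mat 1 \<in> reachable_set_at 0 i j m1 m2 0 (mat 1)"
    unfolding reachable_set_at_def mem_Collect_eq
    by (intro exI[of _ "\<lambda>_ _. 0"] exI[of _ "\<lambda>_. mat 1"]) simp
  then show ?thesis by (auto simp: reachable_set_def)
qed

text \<open>
  After time \<open>T\<close> run only the control of arc \<open>k\<close>, at the constant value \<open>c\<close>, for one more unit of
  time.  As \<open>E\<^sub>p\<^sub>q\<close> squares to zero for \<open>p \<noteq> q\<close>, its exponential is \<open>I + t c E\<^sub>p\<^sub>q\<close>, so that the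
  continuation of the trajectory is an explicit affine function of time.
\<close>

lemma arc_shear_reachable:
  assumes k: "k \<in> {1..m1}" and "i k \<noteq> j k"
    and "Z \<in> reachable_set 0 i j m1 m2 X0"
  shows "shear (i k) (j k) c Z \<in> reachable_set 0 i j m1 m2 X0"
proof -
  obtain T u S X where T: "0 \<le> T" and pc: "\<forall>l\<in>{1..m2}. piecewise_constant_on (u l) T"
    and S: "finite S" and cont: "continuous_on {0..T} X"
    and deriv: "\<forall>t\<in>{0..T} - S.
      (X has_vector_derivative system_matrix 0 i j m1 m2 u t ** X t) (at t within {0..T})"
    and X: "X 0 = X0" "X T = Z"
    by (rule reachable_setE[OF assms(3)])
  let ?E = "E_mat (i k) (j k)"
  define u' where "u' l t = (if t \<le> T then u l t else if l = k then c else 0)" for l t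
  define Y where "Y t = shear (i k) (j k) ((t - T) * c) Z" for t
  define X' where "X' t = (if t \<le> T then X t else Y t)" for t
  have Y: "Y t = Z + ((t - T) * c) *\<^sub>R (?E ** Z)" for t
    by (simp add: Y_def shear_eq_add_scaled_product)
  have early: "system_matrix 0 i j m1 m2 u' t = system_matrix 0 i j m1 m2 u t" if "t \<le> T" for t
    using that by (simp add: system_matrix_def u'_def)
  have late: "system_matrix 0 i j m1 m2 u' t = c *\<^sub>R ?E" if "T < t" for t
  proof -
    have "(\<Sum>l = 1..m1. u' l t *\<^sub>R E_mat (i l) (j l)) = (\<Sum>l = 1..m1. if l = k then c *\<^sub>R ?E else 0)"
      using that by (intro sum.cong) (auto simp: u'_def)
    also have "\<dots> = c *\<^sub>R ?E" using k by simp
    finally have "(\<Sum>l = 1..m1. u' l t *\<^sub>R E_mat (i l) (j l)) = c *\<^sub>R ?E" .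
    moreover have "(\<Sum>l = m1 + 1..m2. u' l t *\<^sub>R C_mat (i l) (j l)) = 0"
      using that k by (intro sum.neutral) (auto simp: u'_def)
    ultimately show ?thesis by (simp add: system_matrix_def)
  qed
  have dY: "(Y has_vector_derivative (c *\<^sub>R ?E) ** Y t) (at t within A)" for t A
  proof -
    have "(c *\<^sub>R ?E) ** Y t = c *\<^sub>R (?E ** Z)"
      using \<open>i k \<noteq> j k\<close> by (simp add: scalar_matrix_assoc[symmetric] vec_eq_iff Y_def)
    then show ?thesis unfolding Y by (auto intro!: derivative_eq_intros)
  qed
  have "is_solution 0 i j m1 m2 u' (T + 1) X'"
    unfolding is_solution_def
  proof (intro conjI exI[of _ "insert T S"] ballI)
    have "continuous_on ({0..T} \<union> {T..T + 1}) X'"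
      unfolding X'_def
    proof (rule continuous_on_If)
      show "continuous_on {T..T + 1} Y" unfolding Y by (intro continuous_intros)
    qed (use cont X in \<open>auto simp: Y\<close>)
    then show "continuous_on {0..T + 1} X'" using T by (simp add: ivl_disj_un_two_touch)
    show "finite (insert T S)" using S by simp
  next
    fix t assume t: "t \<in> {0..T + 1} - insert T S"
    show "(X' has_vector_derivative system_matrix 0 i j m1 m2 u' t ** X' t) (at t within {0..T + 1})"
    proof (cases "t < T")
      case True
      have "at t within {0..T} = at t within {0..T + 1}"
        by (rule at_within_nhd[of _ "{..<T}"]) (use True in auto)
      then have "(X has_vector_derivative system_matrix 0 i j m1 m2 u t ** X t) (at t within {0..T + 1})"
        using deriv[rule_format, of t] t True by auto
      then have "(X' has_vector_derivative system_matrix 0 i j m1 m2 u t ** X t) (at t within {0..T + 1})"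
        by (rule has_vector_derivative_transform_within[where d = "T - t"])
          (use t True in \<open>auto simp: X'_def dist_real_def\<close>)
      then show ?thesis using True by (simp add: early X'_def)
    next
      case False
      then have "T < t" using t by auto
      from dY have "(X' has_vector_derivative (c *\<^sub>R ?E) ** Y t) (at t within {0..T + 1})"
        by (rule has_vector_derivative_transform_within[where d = "t - T"])
          (use t \<open>T < t\<close> in \<open>auto simp: X'_def dist_real_def\<close>)
      then show ?thesis using \<open>T < t\<close> by (simp add: late X'_def)
    qed
  qed
  moreover have "piecewise_constant_on (u' l) (T + 1)" if l: "l \<in> {1..m2}" for l
  proof -
    obtain P where "finite P"
      and P: "\<And>a b. {a..b} \<subseteq> {0..T} - P \<Longrightarrow> u l constant_on {a..b}"
      using pc[rule_format, OF l] unfolding piecewise_constant_on_def by blast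
    have "u' l constant_on {a..b}" if ab: "{a..b} \<subseteq> {0..T + 1} - insert T P" for a b
    proof -
      have "\<not> (a \<le> T \<and> T \<le> b)" using ab by auto
      then consider "b < a" | "b < T" | "T < a" by linarith
      then show ?thesis
      proof cases
        case 1
        then show ?thesis by (simp add: constant_on_def)
      next
        case 2
        then have "{a..b} \<subseteq> {0..T} - P" using ab by force
        from P[OF this] obtain y where "\<forall>t\<in>{a..b}. u l t = y" by (auto simp: constant_on_def)
        then show ?thesis using 2 by (auto simp: constant_on_def u'_def)
      next
        case 3
        then show ?thesis by (auto simp: constant_on_def u'_def)
      qed
    qed
    then show ?thesis unfolding piecewise_constant_on_def
      using \<open>finite P\<close> by (intro exI[of _ "insert T P"]) auto
  qed
  moreover have "X' 0 = X0" using X T by (simp add: X'_def)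
  moreover have "X' (T + 1) = shear (i k) (j k) c Z" by (simp add: X'_def Y_def)
  ultimately have "shear (i k) (j k) c Z \<in> reachable_set_at 0 i j m1 m2 (T + 1) X0"
    unfolding reachable_set_at_def mem_Collect_eq by (intro exI[of _ u'] exI[of _ X']) auto
  then show ?thesis using T unfolding reachable_set_def by (intro UN_I[of "T + 1"]) auto
qed

lemma SL_reachable:
  fixes i j :: "nat \<Rightarrow> 'n::finite"
  assumes loopless: "\<And>k. k \<in> {1..m1} \<Longrightarrow> i k \<noteq> j k"
    and connected: "\<And>p q. (p, q) \<in> {(i k, j k) | k. k \<in> {1..m1}}\<^sup>*"
  shows "SL \<subseteq> reachable_set 0 i j m1 m2 (mat 1)"
proof (rule SL_subset_if_shear_closed[OF identity_reachable])
  fix p q :: 'n and c X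
  assume "p \<noteq> q" "X \<in> reachable_set 0 i j m1 m2 (mat 1)"
  with _ connected show "shear p q c X \<in> reachable_set 0 i j m1 m2 (mat 1)"
    by (rule path_shear_closed) (auto intro!: arc_shear_reachable loopless)
qed

lemma reachable_subset_SL:
  assumes "\<And>k. k \<in> {1..m1} \<Longrightarrow> i k \<noteq> j k"
  shows "reachable_set 0 i j m1 m2 (mat 1) \<subseteq> SL"
proof
  fix Z assume "Z \<in> reachable_set 0 i j m1 m2 (mat 1)"
  then obtain T u S X where T: "0 \<le> T"
    and "\<forall>l\<in>{1..m2}. piecewise_constant_on (u l) T" and sol: "finite S" "continuous_on {0..T} X"
      "\<forall>t\<in>{0..T} - S.
        (X has_vector_derivative system_matrix 0 i j m1 m2 u t ** X t) (at t within {0..T})"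
    and X: "X 0 = mat 1" "X T = Z"
    by (rule reachable_setE)
  from det_constant[OF T sol(1,2) sol(3)[rule_format] trace_system_matrix[OF assms]] show "Z \<in> SL"
    using X by (simp add: SL_def)
qed

text \<open>
  If no arc leaves \<open>R\<close>, the span of the basis vectors with index outside \<open>R\<close> is invariant
  under every system matrix, and hence under every reachable state.
\<close>

lemma reachable_zero_block:
  assumes "m1 \<le> m2"
    and closed: "\<And>k. k \<in> {1..m1} \<Longrightarrow> i k \<in> R \<Longrightarrow> j k \<in> R"
    and "Z \<in> reachable_set 0 i j m1 m2 (mat 1)" "p \<in> R" "q \<notin> R"
  shows "Z $ p $ q = 0"
proof -
  obtain T u S X where T: "0 \<le> T" and pc: "\<forall>l\<in>{1..m2}. piecewise_constant_on (u l) T"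
    and sol: "finite S" "continuous_on {0..T} X"
      "\<forall>t\<in>{0..T} - S.
        (X has_vector_derivative system_matrix 0 i j m1 m2 u t ** X t) (at t within {0..T})"
    and X: "X 0 = mat 1" "X T = Z"
    by (rule reachable_setE[OF assms(3)])
  obtain M where M: "\<And>t. t \<in> {0..T} \<Longrightarrow> norm (system_matrix 0 i j m1 m2 u t) \<le> M"
    using bounded_system_matrix[OF \<open>m1 \<le> m2\<close> pc, of 0 i j] by blast
  have "X T $ p $ q = 0"
  proof (rule zero_block_invariant[OF T sol(1,2) sol(3)[rule_format] M])
    show "system_matrix 0 i j m1 m2 u t $ r $ s = 0" if "r \<in> R" "s \<notin> R" for t r s
      using that closed by (intro system_matrix_nth_eq_0) auto
    show "X 0 $ r $ q = 0" if "r \<in> R" for r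
      using that \<open>q \<notin> R\<close> X by (auto simp: mat_def)
  qed (use \<open>p \<in> R\<close> in auto)
  then show ?thesis using X by simp
qed

theorem proposition2:
  fixes A :: "real^'n^'n" and i j :: "nat \<Rightarrow> 'n" and m1 m2 :: nat
  assumes "m1 \<le> m2"
    and "A \<in> sl"
    and "\<forall>k\<in>{1..m1}. E_mat (i k) (j k) \<in> {E_mat p q :: real^'n^'n | p q. p \<noteq> q}"
    and "\<forall>k\<in>{m1+1..m2}. C_mat (i k) (j k) \<in> {C_mat p q :: real^'n^'n | p q. p \<noteq> q}"
    and "A = 0"
  shows "controllable_on_SL A i j m1 m2 \<longleftrightarrow> strongly_connected (with_proj (contr_graph i j m1))"
proof -
  have loopless: "i k \<noteq> j k" if k: "k \<in> {1..m1}" for k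
  proof -
    obtain p q where "E_mat (i k) (j k) = (E_mat p q :: real^'n^'n)" "p \<noteq> q"
      using assms(3)[rule_format, OF k] by blast
    then have "trace (E_mat (i k) (j k) :: real^'n^'n) = 0" by (simp add: trace_E_mat)
    then show ?thesis by (simp add: trace_E_mat split: if_splits)
  qed
  define E where "E = {(i k, j k) | k. k \<in> {1..m1}}"
  \<comment> \<open>All of the index type is the vertex set, so reachability in the graph is the plain closure.\<close>
  have "rtrancl_on UNIV E = E\<^sup>*"
  proof (rule set_eqI, rule iffI)
    show "x \<in> E\<^sup>*" if "x \<in> rtrancl_on UNIV E" for x
      using that by (cases x) (auto dest: rtrancl_on_rtranclI)
    show "x \<in> rtrancl_on UNIV E" if "x \<in> E\<^sup>*" for x
      using that by (cases x) (auto intro: rtrancl_consistent_rtrancl_on)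
  qed
  then have graph: "strongly_connected (with_proj (contr_graph i j m1)) \<longleftrightarrow> (\<forall>p q. (p, q) \<in> E\<^sup>*)"
    by (simp add: strongly_connected_def reachable_def contr_graph_def E_def)
  show ?thesis unfolding graph
  proof
    assume "\<forall>p q. (p, q) \<in> E\<^sup>*"
    then have "SL \<subseteq> reachable_set 0 i j m1 m2 (mat 1)"
      using loopless by (intro SL_reachable) (auto simp: E_def)
    then show "controllable_on_SL A i j m1 m2"
      using reachable_subset_SL[of m1 i j m2] loopless \<open>A = 0\<close>
      by (auto simp: controllable_on_SL_def)
  next
    assume contr: "controllable_on_SL A i j m1 m2"
    show "\<forall>p q. (p, q) \<in> E\<^sup>*"
    proof (rule ccontr)
      assume "\<not> ?thesis"
      then obtain p q where pq: "(p, q) \<notin> E\<^sup>*" by blast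
      then have "p \<noteq> q" by auto
      \<comment> \<open>the witness that is never reached\<close>
      have "shear p q 1 (mat 1) \<in> SL" using \<open>p \<noteq> q\<close> by (simp add: SL_def det_shear)
      then have "shear p q 1 (mat 1) \<in> reachable_set 0 i j m1 m2 (mat 1)"
        using contr \<open>A = 0\<close> by (simp add: controllable_on_SL_def)
      then have "shear p q 1 (mat 1) $ p $ q = 0"
      proof (rule reachable_zero_block[OF \<open>m1 \<le> m2\<close>, where R = "{r. (p, r) \<in> E\<^sup>*}", rotated])
        show "j k \<in> {r. (p, r) \<in> E\<^sup>*}" if "k \<in> {1..m1}" "i k \<in> {r. (p, r) \<in> E\<^sup>*}" for k
          using that by (auto simp: E_def intro: rtrancl_into_rtrancl)
      qed (use pq in auto)
      then show False using \<open>p \<noteq> q\<close> by (simp add: mat_def)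
    qed
  qed
qed

end
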